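(* Let $q$ be a prime power and let $f\in\mathbb{F}_q[x]$ with $\deg(f)\geq 1$. Let $a\in\mathbb{F}_q$ be such that $h$ is the least degree polynomial with $f(x)\mid (h\circ x-a)$. Then $\mathrm{Ord}(f)=\mathrm{Ord}(a)\cdot h$.
   Context: For $g(x)=\sum_i a_i x^i\in\mathbb{F}_q[x]$ and $\beta$ in an extension field of $\mathbb{F}_q$, write $g\circ\beta=\sum_i a_i\beta^{q^i}$; similarly $g\circ x=\sum_i a_i x^{q^i}\in\mathbb{F}_q[x]$. Here $h$ is a polynomial in $\mathbb{F}_q[x]$. $\mathbb{F}_q$-Order of an element: $\mathrm{Ord}(a)$ is the unique monic polynomial $g\in\mathbb{F}_q[x]$ of least degree such that $g\circ a=0$. $\mathbb{F}_q$-Order of a polynomial: for $f\in\mathbb{F}_q[x]$ of degree at least $1$, $\mathrm{Ord}(f)$ is the monic polynomial $g\in\mathbb{F}_q[x]$ of least degree such that $f\mid g\circ x$ in $\mathbb{F}_q[x]$.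
   Formalization: The polynomial h is assumed monic, and of least degree among nonzero polynomials g with f | g∘x − a; without this the claim fails, e.g. q = 3, f = x − 1, a = 2, h = 2, or h = 0 when a = 0. *)

theory Defs
  imports "HOL-Computational_Algebra.Computational_Algebra"
begin

text \<open>
  The base field of \<open>q\<close> elements is a type \<open>'a\<close> of class \<open>finite_field\<close>, so \<open>q = card (UNIV :: 'a set)\<close>.
  An extension of it (an extension field, or the polynomial ring over it) is given by a ring \<open>'b\<close>
  together with the embedding \<open>emb\<close> of the base field into \<open>'b\<close>: the identity for the base field
  itself, and \<open>\<lambda>c. [:c:]\<close> for the polynomial ring. The definitions are only meaningful when
  \<open>emb\<close> is a ring homomorphism.
\<close>

definition q_act :: "('a::finite_field \<Rightarrow> 'b::comm_ring_1) \<Rightarrow> 'a poly \<Rightarrow> 'b \<Rightarrow> 'b" where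
  "q_act emb g \<beta> = (\<Sum>i\<le>degree g. emb (coeff g i) * \<beta> ^ (card (UNIV :: 'a set) ^ i))"

abbreviation q_act_X :: "'a::finite_field poly \<Rightarrow> 'a poly" where
  "q_act_X g \<equiv> q_act (\<lambda>c. [:c:]) g [:0, 1:]"

definition Ord_elem :: "('a::finite_field \<Rightarrow> 'b::field) \<Rightarrow> 'b \<Rightarrow> 'a poly" where
  "Ord_elem emb \<beta> = (THE g. is_arg_min degree (\<lambda>g. lead_coeff g = 1 \<and> q_act emb g \<beta> = 0) g)"

definition Ord_poly :: "'a::finite_field poly \<Rightarrow> 'a poly" where
  "Ord_poly f = (THE g. is_arg_min degree (\<lambda>g. lead_coeff g = 1 \<and> f dvd q_act_X g) g)"

end

theory Submission
  imports Defs
begin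

text \<open>
  The polynomials \<open>g\<close> with \<open>f dvd g \<circ> x\<close> form an ideal, because \<open>(x g) \<circ> x = (g \<circ> x)\<^sup>q\<close>.
  If \<open>a = 0\<close>, then \<open>Ord a = 1\<close> and \<open>h\<close> generates this ideal by assumption. If \<open>a \<noteq> 0\<close>, then
  \<open>Ord a = x - 1\<close>, and \<open>(x - 1) h\<close> lies in the ideal because \<open>a\<^sup>q = a\<close>. Reducing \<open>h\<close> modulo a
  nonzero ideal element \<open>g\<close> does not change \<open>h \<circ> x\<close> modulo \<open>f\<close>, so the minimality of \<open>h\<close> forces
  \<open>degree h < degree g\<close>; hence \<open>(x - 1) h\<close> has the least degree in the ideal.
\<close>

text \<open>
  Since \<open>(c + 1)\<^sup>q = c\<^sup>q + 1\<close> for all \<open>c\<close> in the field, \<open>(X + 1)\<^sup>q - X\<^sup>q - 1\<close> has \<open>q\<close> roots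
  but degree less than \<open>q\<close>. This avoids showing that \<open>q\<close> is a power of the characteristic.
\<close>
lemma of_nat_card_choose_eq_0:
  assumes "0 < k" "k < card (UNIV :: 'a::finite_field set)"
  shows "(of_nat (card (UNIV :: 'a set) choose k) :: 'a) = 0"
proof -
  define q where "q = card (UNIV :: 'a set)"
  define P :: "'a poly" where "P = (\<Sum>i\<in>{0<..<q}. monom (of_nat (q choose i)) i)"
  have q: "q > 0" using assms by (simp add: q_def)
  have "poly P c = 0" for c
  proof -
    have "(c + 1) ^ q = (\<Sum>i\<le>q. of_nat (q choose i) * c ^ i)"
      by (simp add: binomial_ring)
    also have "{..q} = insert 0 (insert q {0<..<q})" by auto
    also have "(\<Sum>i\<in>\<dots>. of_nat (q choose i) * c ^ i) = 1 + c ^ q + poly P c"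
      using q by (simp add: P_def poly_sum poly_monom add.assoc)
    finally show ?thesis
      by (simp add: q_def finite_field_power_card_eq_same)
  qed
  moreover have "degree P \<le> q - 1"
    unfolding P_def by (intro degree_sum_le) (auto intro!: order.trans[OF degree_monom_le])
  ultimately have "P = 0"
    using card_poly_roots_bound[of P] q by (cases "P = 0") (auto simp: q_def)
  then have "coeff P k = 0" by simp
  moreover have "coeff P k = of_nat (q choose k)"
    using assms by (simp add: P_def coeff_sum coeff_monom q_def if_distrib cong: if_cong)
  ultimately show ?thesis by (simp add: q_def)
qed

text \<open>The inner binomial coefficients vanish already in the field, hence also as constant
  polynomials.\<close>

lemma poly_power_card_add:
  fixes x y :: "'a::finite_field poly"
  shows "(x + y) ^ card (UNIV :: 'a set) = x ^ card (UNIV :: 'a set) + y ^ card (UNIV :: 'a set)"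
proof -
  define q where "q = card (UNIV :: 'a set)"
  have q: "q > 0" by (simp add: q_def card_gt_0_iff)
  have "(x + y) ^ q = (\<Sum>i\<le>q. of_nat (q choose i) * x ^ i * y ^ (q - i))"
    by (simp add: binomial_ring)
  also have "{..q} = insert 0 (insert q {0<..<q})" by auto
  also have "(\<Sum>i\<in>\<dots>. of_nat (q choose i) * x ^ i * y ^ (q - i)) = y ^ q + x ^ q
      + (\<Sum>i\<in>{0<..<q}. of_nat (q choose i) * x ^ i * y ^ (q - i))"
    using q by (simp add: add.assoc)
  also have "(\<Sum>i\<in>{0<..<q}. of_nat (q choose i) * x ^ i * y ^ (q - i)) = 0"
    by (intro sum.neutral) (auto simp: q_def of_nat_poly of_nat_card_choose_eq_0)
  finally show ?thesis by (simp add: q_def add.commute)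
qed

lemma poly_power_card_diff:
  fixes x y :: "'a::finite_field poly"
  shows "(x - y) ^ card (UNIV :: 'a set) = x ^ card (UNIV :: 'a set) - y ^ card (UNIV :: 'a set)"
  using poly_power_card_add[of "x - y" y] by (simp add: algebra_simps)

lemma q_act_X_0 [simp]: "q_act_X (0 :: 'a::finite_field poly) = 0"
  by (simp add: q_act_def)

text \<open>The free bound \<open>n\<close> allows polynomials of different degrees to be summed
  over one range.\<close>

lemma q_act_X_altdef:
  fixes g :: "'a::finite_field poly"
  assumes "degree g \<le> n"
  shows "q_act_X g = (\<Sum>i\<le>n. monom (coeff g i) (card (UNIV :: 'a set) ^ i))"
proof -
  have "q_act_X g = (\<Sum>i\<le>degree g. monom (coeff g i) (card (UNIV :: 'a set) ^ i))"
    by (simp add: q_act_def monom_altdef)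
  also have "\<dots> = (\<Sum>i\<le>n. monom (coeff g i) (card (UNIV :: 'a set) ^ i))"
    using assms by (intro sum.mono_neutral_left) (auto simp: coeff_eq_0)
  finally show ?thesis .
qed

lemma q_act_X_add: "q_act_X (g + h) = q_act_X g + q_act_X (h :: 'a::finite_field poly)"
proof -
  let ?n = "max (degree g) (degree h)"
  have "degree (g + h) \<le> ?n" by (rule degree_add_le_max)
  then show ?thesis
    by (simp add: q_act_X_altdef[where n = ?n] sum.distrib flip: add_monom)
qed

lemma q_act_X_smult: "q_act_X (smult c g) = smult c (q_act_X (g :: 'a::finite_field poly))"
  using degree_smult_le[of c g]
  by (simp add: q_act_X_altdef[where n = "degree g"] poly_eq_iff coeff_sum sum_distrib_left
      mult_delta_right)

lemma q_act_X_diff: "q_act_X (g - h) = q_act_X g - q_act_X (h :: 'a::finite_field poly)"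
  using q_act_X_add[of "g - h" h] by simp

text \<open>A Horner rule: the additive \<open>q\<close>-th power map shifts each exponent
  \<open>q ^ i\<close> to \<open>q ^ Suc i\<close> and fixes the coefficients, since they lie in the
  field of \<open>q\<close> elements.\<close>

lemma q_act_X_pCons:
  fixes g :: "'a::finite_field poly"
  shows "q_act_X (pCons c g) = [:0, c:] + q_act_X g ^ card (UNIV :: 'a set)"
proof -
  define q where "q = card (UNIV :: 'a set)"
  have "q > 0" by (simp add: q_def card_gt_0_iff)
  have sum_power: "(\<Sum>i\<in>A. u i) ^ q = (\<Sum>i\<in>A. u i ^ q)"
    if "finite A" for A and u :: "nat \<Rightarrow> 'a poly"
    using that by (induction rule: finite_induct) (use \<open>q > 0\<close> in \<open>simp_all add: q_def poly_power_card_add\<close>)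
  have "q_act_X (pCons c g) = (\<Sum>i\<le>Suc (degree g). monom (coeff (pCons c g) i) (q ^ i))"
    unfolding q_def by (intro q_act_X_altdef) (rule degree_pCons_le)
  also have "\<dots> = [:0, c:] + (\<Sum>i\<le>degree g. monom (coeff g i) (q ^ Suc i))"
    by (subst sum.atMost_Suc_shift) (simp add: monom_altdef)
  also have "(\<Sum>i\<le>degree g. monom (coeff g i) (q ^ Suc i)) = (\<Sum>i\<le>degree g. monom (coeff g i) (q ^ i)) ^ q"
    unfolding sum_power[OF finite_atMost]
    by (simp add: monom_power mult.commute q_def finite_field_power_card_eq_same)
  finally show ?thesis
    by (simp add: q_act_X_altdef[of g "degree g"] q_def)
qed

text \<open>Horner induction on \<open>p\<close>: a scalar factor is harmless, and a factor
  \<open>x\<close> turns the action into its \<open>q\<close>-th power, which \<open>f\<close> still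
  divides.\<close>

lemma dvd_q_act_X_mult:
  fixes f g p :: "'a::finite_field poly"
  assumes "f dvd q_act_X g"
  shows "f dvd q_act_X (p * g)"
proof (induction p)
  case 0
  then show ?case by simp
next
  case (pCons c p)
  have "card (UNIV :: 'a set) \<noteq> 0" by simp
  then have "f dvd q_act_X (p * g) ^ card (UNIV :: 'a set)"
    using pCons.IH by (metis dvd_power dvd_trans neq0_conv)
  then show ?case
    using assms by (simp add: q_act_X_add q_act_X_smult q_act_X_pCons dvd_smult)
qed

text \<open>Two distinct monic candidates of the same least degree would have a nonzero difference
  of smaller degree. Closure under differences and scalars suffices, so one argument serves both
  kinds of order.\<close>

lemma the_arg_min_degree_monic:
  fixes p :: "'a::field poly"
  assumes "lead_coeff p = 1" "P p"
    and diff: "\<And>g h. P g \<Longrightarrow> P h \<Longrightarrow> P (g - h)"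
    and smult: "\<And>c g. P g \<Longrightarrow> P (smult c g)"
    and least: "\<And>g. lead_coeff g = 1 \<Longrightarrow> P g \<Longrightarrow> degree p \<le> degree g"
  shows "(THE g. is_arg_min degree (\<lambda>g. lead_coeff g = 1 \<and> P g) g) = p"
proof (rule the_equality)
  show "is_arg_min degree (\<lambda>g. lead_coeff g = 1 \<and> P g) p"
    using assms by (auto simp: is_arg_min_linorder)
next
  fix g assume "is_arg_min degree (\<lambda>g. lead_coeff g = 1 \<and> P g) g"
  then have g: "lead_coeff g = 1" "P g" "degree g = degree p"
    using assms by (auto simp: is_arg_min_linorder intro: antisym)
  show "g = p"
  proof (rule ccontr)
    assume "g \<noteq> p"
    define d where "d = g - p"
    have d: "d \<noteq> 0" "coeff d (degree p) = 0" "degree d \<le> degree p" "P d"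
      using \<open>g \<noteq> p\<close> g assms by (auto simp: d_def degree_diff_le)
    then have "degree d < degree p"
      by (metis leading_coeff_0_iff le_neq_implies_less)
    \<comment> \<open>\<open>least\<close> speaks of monic polynomials only, so \<open>d\<close> is
      normalised first.\<close>
    moreover have "degree p \<le> degree (smult (inverse (lead_coeff d)) d)"
      using d by (intro least smult) auto
    ultimately show False using d(1) by simp
  qed
qed

text \<open>The \<open>q\<close>-th power map fixes \<open>a\<close>, so \<open>g\<close> acts on
  \<open>a\<close> as multiplication by \<open>g(1)\<close>. For nonzero \<open>a\<close> the
  annihilators are thus the polynomials with root 1.\<close>

lemma Ord_elem_base:
  fixes a :: "'a::finite_field"
  shows "Ord_elem (\<lambda>c. c) a = (if a = 0 then 1 else [:-1, 1:])"
proof -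
  have act: "q_act (\<lambda>c. c) g a = poly g 1 * a" for g :: "'a poly"
    by (simp add: q_act_def poly_altdef finite_field_power_card_power_eq_same sum_distrib_right)
  have "degree (if a = 0 then 1 else [:-1, 1:] :: 'a poly) \<le> degree g"
    if "lead_coeff g = 1" "poly g 1 * a = 0" for g
    using that by (cases "degree g = 0") (auto elim!: degree_eq_zeroE)
  then show ?thesis
    unfolding Ord_elem_def act
    by (intro the_arg_min_degree_monic) (auto simp: algebra_simps)
qed

theorem theorem13:
  fixes f h :: "'a::finite_field poly" and a :: 'a
  assumes "degree f \<ge> 1"
    and "lead_coeff h = 1"
    and "is_arg_min degree (\<lambda>g. g \<noteq> 0 \<and> f dvd (q_act_X g - [:a:])) h"
  shows "Ord_poly f = Ord_elem (\<lambda>c. c) a * h"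
proof -
  define m where "m = Ord_elem (\<lambda>c. c) a * h"
  have h: "h \<noteq> 0" "f dvd q_act_X h - [:a:]"
    and least: "\<And>g. g \<noteq> 0 \<Longrightarrow> f dvd q_act_X g - [:a:] \<Longrightarrow> degree h \<le> degree g"
    using assms(3) by (auto simp: is_arg_min_linorder)
  have "lead_coeff m = 1 \<and> f dvd q_act_X m \<and>
    (\<forall>g. lead_coeff g = 1 \<longrightarrow> f dvd q_act_X g \<longrightarrow> degree m \<le> degree g)"
  proof (cases "a = 0")
    case True
    then show ?thesis
      using assms(2) h least by (simp add: m_def Ord_elem_base) (metis leading_coeff_0_iff zero_neq_one)
  next
    case False
    let ?q = "card (UNIV :: 'a set)"
    have m: "m = [:-1, 1:] * h" using False by (simp add: m_def Ord_elem_base)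
    have "q_act_X m = q_act_X h ^ ?q - q_act_X h"
      by (simp add: m q_act_X_diff q_act_X_pCons)
    \<comment> \<open>The constants cancel because \<open>a ^ q = a\<close>; now both terms are
      visibly divisible by \<open>f\<close>.\<close>
    also have "\<dots> = (q_act_X h - [:a:]) ^ ?q - (q_act_X h - [:a:])"
      by (simp add: poly_power_card_diff poly_const_pow finite_field_power_card_eq_same)
    finally have "f dvd q_act_X m"
      using h(2) by (simp add: dvd_diff dvd_trans[OF _ dvd_power] card_gt_0_iff)
    moreover have "degree m \<le> degree g" if g: "lead_coeff g = 1" "f dvd q_act_X g" for g
    proof -
      have "f dvd q_act_X (h div g * g)"
        using g(2) by (rule dvd_q_act_X_mult)
      then have "f dvd (q_act_X h - [:a:]) - q_act_X (h div g * g)"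
        using h(2) by (rule dvd_diff[rotated])
      also have "\<dots> = q_act_X (h mod g) - [:a:]"
        by (simp add: q_act_X_diff flip: minus_div_mult_eq_mod)
      finally have r: "f dvd q_act_X (h mod g) - [:a:]" .
      \<comment> \<open>A zero remainder, which \<open>least\<close> does not cover, would make
        \<open>f\<close> of positive degree divide a nonzero constant.\<close>
      have "\<not> f dvd - [:a:]"
        using assms(1) False by (auto dest: dvd_imp_degree_le)
      then have "h mod g \<noteq> 0" using r by (metis q_act_X_0 diff_0)
      \<comment> \<open>The remainder has degree at least \<open>degree h\<close> by minimality and
        below \<open>degree g\<close> by division. The strict gap pays for the extra factor
        \<open>x - 1\<close> in \<open>m\<close>.\<close>
      then have "degree h < degree g"
        using least[OF _ r] degree_mod_less'[of g h] g(1) by force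
      then show ?thesis using h(1) by (simp add: m degree_mult_eq del: mult_pCons_left)
    qed
    moreover have "lead_coeff m = 1"
      using assms(2) by (simp add: m lead_coeff_mult del: mult_pCons_left)
    ultimately show ?thesis by blast
  qed
  then show ?thesis
    unfolding m_def[symmetric] Ord_poly_def
    by (intro the_arg_min_degree_monic) (auto simp: q_act_X_diff q_act_X_smult dvd_smult)
qed

end
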